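(* Every complete metric space $(X,d)$ that is both convex and externally convex is sleek.
   Context: For $x\in X$ and $r>0$, write $B_d(x,r)=\{z\in X: d(x,z)<r\}$ and $B_d[x,r]=\{z\in X: d(x,z)\le r\}$. A metric $d$ is a sleek metric for $X$ if the interior of $B_d[x,r]$ equals $B_d(x,r)$ for all $x\in X$ and $r>0$. A metrizable space is sleek if its topology is induced by a sleek metric. A metric space $(X,d)$ is (metrically) convex if for every pair of distinct points $x,y\in X$ there exists $z\in X\setminus\{x,y\}$ with $d(x,z)+d(z,y)=d(x,y)$. It is externally convex if for every pair of distinct points $x,y\in X$ there exists $z\in X\setminus\{x,y\}$ with $d(x,y)+d(y,z)=d(x,z)$. *)

theory Defs
  imports "HOL-Analysis.Abstract_Metric_Spaces"
begin

text \<open>The interior is taken in the topology that \<open>d\<close> itself induces on \<open>M\<close>.\<close>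

definition sleek_metric :: "'a set \<Rightarrow> ('a \<Rightarrow> 'a \<Rightarrow> real) \<Rightarrow> bool" where
  "sleek_metric M d \<longleftrightarrow> Metric_space M d \<and>
     (\<forall>x\<in>M. \<forall>r>0. Metric_space.mtopology M d interior_of Metric_space.mcball M d x r
                     = Metric_space.mball M d x r)"

definition sleek_space :: "'a topology \<Rightarrow> bool" where
  "sleek_space X \<longleftrightarrow>
     (\<exists>d. sleek_metric (topspace X) d \<and> Metric_space.mtopology (topspace X) d = X)"

definition metrically_convex :: "'a set \<Rightarrow> ('a \<Rightarrow> 'a \<Rightarrow> real) \<Rightarrow> bool" where
  "metrically_convex M d \<longleftrightarrow>
     (\<forall>x\<in>M. \<forall>y\<in>M. x \<noteq> y \<longrightarrow> (\<exists>z\<in>M - {x, y}. d x z + d z y = d x y))"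

definition externally_convex :: "'a set \<Rightarrow> ('a \<Rightarrow> 'a \<Rightarrow> real) \<Rightarrow> bool" where
  "externally_convex M d \<longleftrightarrow>
     (\<forall>x\<in>M. \<forall>y\<in>M. x \<noteq> y \<longrightarrow> (\<exists>z\<in>M - {x, y}. d x y + d y z = d x z))"

end

theory Submission
  imports Defs
begin

text \<open>
  Only points at distance exactly \<open>r\<close> from \<open>x\<close> can lie in the interior of the closed ball of
  radius \<open>r\<close> without lying in the open ball.  Let \<open>z\<close> be such a point.  External convexity
  prolongs the segment from \<open>x\<close> through \<open>z\<close> to some \<open>w\<close>, and every point \<open>u \<noteq> z\<close> metrically
  between \<open>z\<close> and \<open>w\<close> is farther from \<open>x\<close> than \<open>z\<close> is: otherwise the detour
  through \<open>u\<close> would make \<open>d x w\<close> smaller than \<open>d x z + d z w\<close>.  So \<open>z\<close> is not interior as soon as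
  such points \<open>u\<close> exist arbitrarily close to \<open>z\<close>.

  Convexity supplies some point between \<open>z\<close> and \<open>w\<close>, but with no control on its position;
  this is where completeness enters.  Order the points at distance at least \<open>\<epsilon>\<close> from \<open>z\<close> by
  ``\<open>u\<close> lies between \<open>z\<close> and \<open>v\<close>'', that is, \<open>d v u + d z u \<le> d z v\<close>.  This is the order to which
  the variational principle of Ekeland, Caristi and Bishop--Phelps applies, for the potential
  \<open>d z\<close>, and it provides a minimal \<open>v\<close> between \<open>z\<close> and \<open>w\<close>.  A point that convexity places
  strictly between \<open>z\<close> and \<open>v\<close> must then be closer to \<open>z\<close> than \<open>\<epsilon>\<close>, by minimality of \<open>v\<close>.
\<close>

context Metric_space
begin

lemma continuous_map_dist_from:
  assumes "a \<in> M"
  shows "continuous_map mtopology euclideanreal (d a)"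
proof -
  have "continuous_map mtopology Met_TC.mtopology (d a)"
    unfolding metric_continuous_map[OF Met_TC.Metric_space_axioms]
  proof (intro conjI ballI allI impI)
    fix x and e :: real
    assume x: "x \<in> M" and e: "0 < e"
    have "dist (d a x) (d a y) \<le> d x y" if "y \<in> M" for y
      using triangle[OF assms x that] triangle[OF assms that x] commute[of x y]
      by (simp add: dist_real_def abs_le_iff)
    with e show "\<exists>\<delta>>0. \<forall>y. y \<in> M \<and> d x y < \<delta> \<longrightarrow> dist (d a x) (d a y) < e"
      by (meson le_less_trans)
  qed simp
  then show ?thesis by simp
qed

text \<open>
  Call \<open>u\<close> below \<open>v\<close> if \<open>d v u + \<phi> u \<le> \<phi> v\<close>; by the triangle inequality this is transitive.
  Descend greedily from \<open>x\<close>, each step covering at least half of the drop of \<open>\<phi>\<close> that is still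
  possible.  Drops of \<open>\<phi>\<close> bound distances, so the sequence is Cauchy, and its limit \<open>v\<close> lies
  below every member.  A point \<open>u\<close> below \<open>v\<close> was an available target at every step, so greed
  forces \<open>\<phi> v \<le> \<phi> u\<close> in the limit; then \<open>d v u \<le> 0\<close>.
\<close>

lemma caristi_minimal_point:
  fixes \<phi> :: "'a \<Rightarrow> real"
  assumes complete: mcomplete
    and S: "closedin mtopology S"
    and cont: "continuous_map mtopology euclideanreal \<phi>"
    and bdd: "bdd_below (\<phi> ` S)"
    and x: "x \<in> S"
  obtains v where "v \<in> S" "d x v + \<phi> v \<le> \<phi> x"
    and "\<And>u. u \<in> S \<Longrightarrow> d v u + \<phi> u \<le> \<phi> v \<Longrightarrow> u = v"
proof -
  define T where "T v = {u \<in> S. d v u + \<phi> u \<le> \<phi> v}" for v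
  have SM: "S \<subseteq> M"
    using S closedin_metric by blast
  have T_self: "v \<in> T v" if "v \<in> S" for v
    using that SM by (auto simp: T_def)
  have T_trans: "u \<in> T w" if "v \<in> T w" "u \<in> T v" "w \<in> S" for u v w
  proof -
    have "d w u \<le> d w v + d v u"
      using that SM by (intro triangle) (auto simp: T_def)
    then show ?thesis
      using that by (auto simp: T_def)
  qed
  have bddT: "bdd_below (\<phi> ` T v)" for v
    using bdd by (rule bdd_below_mono) (auto simp: T_def)
  \<comment> \<open>A target value halfway to the infimum needs no prescribed error sequence.  If \<open>\<phi> v\<close> already
    equals the infimum, there is no room for a strict choice and the descent stays at \<open>v\<close>.\<close>
  have "\<exists>u \<in> T v. \<phi> u \<le> (\<phi> v + Inf (\<phi> ` T v)) / 2" if v: "v \<in> S" for v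
  proof (cases "Inf (\<phi> ` T v) < \<phi> v")
    case True
    moreover have "\<phi> ` T v \<noteq> {}"
      using T_self[OF v] by blast
    ultimately have "\<exists>y \<in> \<phi> ` T v. y < (\<phi> v + Inf (\<phi> ` T v)) / 2"
      using cInf_lessD[of "\<phi> ` T v" "(\<phi> v + Inf (\<phi> ` T v)) / 2"] by auto
    then show ?thesis
      by (auto intro: less_imp_le)
  next
    case False
    then show ?thesis
      using T_self[OF v] by (intro bexI[of _ v]) auto
  qed
  then obtain f where fT: "\<And>v. v \<in> S \<Longrightarrow> f v \<in> T v"
    and f_half: "\<And>v. v \<in> S \<Longrightarrow> \<phi> (f v) \<le> (\<phi> v + Inf (\<phi> ` T v)) / 2"
    by metis
  define s where "s n = (f ^^ n) x" for n
  have s_0: "s 0 = x" and s_Suc: "s (Suc n) = f (s n)" for n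
    by (simp_all add: s_def)
  have sS: "s n \<in> S" for n
    by (induction n) (use x fT in \<open>auto simp: s_0 s_Suc T_def\<close>)
  have chain: "s n \<in> T (s m)" if "m \<le> n" for m n
    using that
  proof (induction n rule: dec_induct)
    case base
    show ?case by (rule T_self[OF sS])
  next
    case (step n)
    show ?case
      using T_trans[OF step.IH _ sS] fT[OF sS] by (simp add: s_Suc)
  qed
  have drop: "d (s m) (s n) \<le> \<phi> (s m) - \<phi> (s n)" if "m \<le> n" for m n
    using chain[OF that] by (simp add: T_def)
  have "\<phi> (s n) \<le> \<phi> (s m)" if "m \<le> n" for m n
    using drop[OF that] nonneg[of "s m" "s n"] by linarith
  then have "decseq (\<lambda>n. \<phi> (s n))"
    by (simp add: decseq_def)
  moreover obtain b where "\<And>n. b \<le> \<phi> (s n)"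
    using bdd sS by (auto simp: bdd_below_def)
  ultimately obtain L where L: "(\<lambda>n. \<phi> (s n)) \<longlonglongrightarrow> L" and L_le: "\<And>n. L \<le> \<phi> (s n)"
    using decseq_convergent[of "\<lambda>n. \<phi> (s n)" b] by blast
  have "MCauchy s"
    unfolding MCauchy_def
  proof (intro conjI allI impI)
    show "range s \<subseteq> M"
      using sS SM by blast
    fix e :: real
    assume "0 < e"
    then obtain N where N: "\<And>n. n \<ge> N \<Longrightarrow> \<phi> (s n) < L + e"
      using order_tendstoD(2)[OF L, of "L + e"] by (auto simp: eventually_sequentially)
    have ordered: "d (s m) (s n) < e" if "N \<le> m" "m \<le> n" for m n
      using drop[OF that(2)] N[OF that(1)] L_le[of n] by linarith
    have "d (s m) (s n) < e" if "N \<le> m" "N \<le> n" for m n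
      using ordered that commute by (metis nle_le)
    then show "\<exists>N. \<forall>m n. N \<le> m \<longrightarrow> N \<le> n \<longrightarrow> d (s m) (s n) < e"
      by blast
  qed
  then obtain v where lim: "limitin mtopology s v sequentially"
    using complete by (auto simp: mcomplete_def)
  have vS: "v \<in> S"
    using limitin_closedin[OF lim S] sS by simp
  have dist0: "(\<lambda>n. d (s n) v) \<longlonglongrightarrow> 0"
    using lim by (simp add: limitin_metric_dist_null)
  have "(\<lambda>n. \<phi> (s n)) \<longlonglongrightarrow> \<phi> v"
    using continuous_map_limit[OF cont lim] by (simp add: o_def)
  then have Lv: "L = \<phi> v"
    using L LIMSEQ_unique by blast
  have v_below: "v \<in> T (s m)" for m
  proof -
    have "d (s m) v \<le> \<phi> (s m) - \<phi> (s n) + d (s n) v" if "m \<le> n" for n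
    proof -
      have "d (s m) v \<le> d (s m) (s n) + d (s n) v"
        using sS vS SM by (intro triangle) auto
      then show ?thesis
        using drop[OF that] by linarith
    qed
    moreover have "(\<lambda>n. \<phi> (s m) - \<phi> (s n) + d (s n) v) \<longlonglongrightarrow> \<phi> (s m) - L + 0"
      by (intro tendsto_intros L dist0)
    ultimately have "d (s m) v \<le> \<phi> (s m) - L + 0"
      by (intro LIMSEQ_le_const[where a = "d (s m) v"]) auto
    then show ?thesis
      using vS by (simp add: T_def Lv)
  qed
  show thesis
  proof
    show "v \<in> S" by (rule vS)
    show "d x v + \<phi> v \<le> \<phi> x"
      using v_below[of 0] by (simp add: T_def s_0)
    fix u
    assume u: "u \<in> S" "d v u + \<phi> u \<le> \<phi> v"
    have "2 * \<phi> (s (Suc n)) - \<phi> (s n) \<le> \<phi> u" for n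
    proof -
      have "u \<in> T (s n)"
        using T_trans[OF v_below _ sS] u by (simp add: T_def)
      then have "Inf (\<phi> ` T (s n)) \<le> \<phi> u"
        by (intro cInf_lower bddT) auto
      then show ?thesis
        using f_half[OF sS, of n] by (simp add: s_Suc)
    qed
    moreover have "(\<lambda>n. 2 * \<phi> (s (Suc n)) - \<phi> (s n)) \<longlonglongrightarrow> 2 * L - L"
      by (intro tendsto_intros L LIMSEQ_Suc)
    ultimately have "2 * L - L \<le> \<phi> u"
      by (intro LIMSEQ_le_const2[where a = "\<phi> u"]) auto
    then have "d v u \<le> 0"
      using u by (simp add: Lv)
    then show "u = v"
      using nonneg[of v u] zero[of v u] u vS SM by auto
  qed
qed

text \<open>
  Apply the minimal point principle to the potential \<open>d z\<close> on the closed set of points at least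
  \<open>\<epsilon>\<close> away from \<open>z\<close>, starting from \<open>w\<close>.  Convexity can still move the minimal point \<open>v\<close> towards
  \<open>z\<close>, so the resulting point has to leave that set; betweenness is transitive, so it also lies
  between \<open>z\<close> and \<open>w\<close>.
\<close>

lemma between_point_near_endpoint:
  assumes complete: mcomplete
    and convex: "metrically_convex M d"
    and z: "z \<in> M" and w: "w \<in> M" and "z \<noteq> w" and "0 < \<epsilon>"
  obtains u where "u \<in> M" "u \<noteq> z" "d z u < \<epsilon>" "d z u + d u w = d z w"
proof (cases "d z w < \<epsilon>")
  case True
  then show thesis
    using that[of w] w \<open>z \<noteq> w\<close> by simp
next
  case False
  define S where "S = M - mball z \<epsilon>"
  have S_iff: "y \<in> S \<longleftrightarrow> y \<in> M \<and> \<epsilon> \<le> d z y" for y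
    using z by (auto simp: S_def)
  have closed: "closedin mtopology S"
    unfolding S_def by (intro closedin_diff openin_mball) simp
  have bdd: "bdd_below (d z ` S)"
    by (rule bdd_belowI2[of _ 0]) simp
  have wS: "w \<in> S"
    using False w by (simp add: S_iff)
  obtain v where v: "v \<in> S" "d w v + d z v \<le> d z w"
    and minimal: "\<And>u. u \<in> S \<Longrightarrow> d v u + d z u \<le> d z v \<Longrightarrow> u = v"
    using caristi_minimal_point[OF complete closed continuous_map_dist_from[OF z] bdd wS] by blast
  have vM: "v \<in> M" and "z \<noteq> v"
    using v \<open>0 < \<epsilon>\<close> by (auto simp: S_iff)
  then obtain u where u: "u \<in> M" "u \<noteq> z" "u \<noteq> v" "d z u + d u v = d z v"
    using convex z unfolding metrically_convex_def by blast
  have "u \<notin> S"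
    using minimal[of u] u commute[of u v] by auto
  then have "d z u < \<epsilon>"
    using u by (simp add: S_iff)
  moreover have "d z u + d u w = d z w"
    using triangle[OF z u(1) w] triangle[OF u(1) vM w] commute[of w v] u v by linarith
  ultimately show thesis
    using that u by blast
qed

lemma interior_of_mcball_eq_mball:
  assumes complete: mcomplete
    and convex: "metrically_convex M d" and ext: "externally_convex M d"
    and x: "x \<in> M" and "0 < r"
  shows "mtopology interior_of mcball x r = mball x r"
proof
  show "mball x r \<subseteq> mtopology interior_of mcball x r"
    by (intro interior_of_maximal mball_subset_mcball openin_mball)
  show "mtopology interior_of mcball x r \<subseteq> mball x r"
  proof
    fix z
    assume "z \<in> mtopology interior_of mcball x r"
    then obtain \<epsilon> where z: "z \<in> M" and "0 < \<epsilon>" and ball: "mball z \<epsilon> \<subseteq> mcball x r"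
      by (auto simp: metric_interior_of)
    then have zr: "d x z \<le> r"
      by auto
    have "d x z \<noteq> r"
    proof
      assume r: "d x z = r"
      then have "x \<noteq> z"
        using \<open>0 < r\<close> x by auto
      then obtain w where w: "w \<in> M" "w \<noteq> z" "d x z + d z w = d x w"
        using ext x z unfolding externally_convex_def by blast
      then obtain u where u: "u \<in> M" "u \<noteq> z" "d z u < \<epsilon>" "d z u + d u w = d z w"
        using between_point_near_endpoint[OF complete convex z w(1) _ \<open>0 < \<epsilon>\<close>] by metis
      have "d x u \<le> r"
        using ball u z by auto
      moreover have "0 < d z u"
        using u z by simp
      ultimately show False
        using triangle[OF x u(1) w(1)] u w r by linarith
    qed
    then show "z \<in> mball x r"
      using zr x z by simp
  qed
qed

end

theorem corollary3p11:
  fixes M :: "'a set" and d :: "'a \<Rightarrow> 'a \<Rightarrow> real"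
  assumes "Metric_space M d"
    and "Metric_space.mcomplete M d"
    and "metrically_convex M d"
    and "externally_convex M d"
  shows "sleek_metric M d \<and> sleek_space (Metric_space.mtopology M d)"
proof -
  interpret Metric_space M d by fact
  have "sleek_metric M d"
    using interior_of_mcball_eq_mball assms Metric_space_axioms by (simp add: sleek_metric_def)
  then show ?thesis
    by (auto simp: sleek_space_def)
qed

end
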